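(* Let $K$ be a field and let $I=(m)\subset R=K[x_1,\dots,x_n]$ be a principal monomial ideal, where $m=x_1^{a_1}x_2^{a_2}\cdots x_n^{a_n}$. Then a monomial ideal $J\subseteq I$ is a demotion of $I$ if and only if $J=(mu_1,\dots,mu_t)$, where $u_1,\dots,u_t$ are monomials with $\mathcal{G}(J)=\{mu_1,\dots,mu_t\}$ and $\mathrm{supp}(u_i)\cap \mathrm{supp}(m)=\emptyset$ for all $i=1,\ldots,t$. In particular, $I$ admits proper demotions whenever $\mathrm{supp}(m)\subsetneq \{x_1,\dots,x_n\}$.
   Context: For ideals $J\subseteq I$ in a commutative Noetherian ring $R$, $J$ is a demotion of $I$ if $I^rJ^s=I^{r+s}\cap J^s$ for all integers $r,s\geq 0$ (with $I^0=J^0=R$); it is a proper demotion of $I$ if moreover $J\neq I$. For a monomial ideal $J$, $\mathcal{G}(J)$ denotes its unique minimal set of monomial generators (for $J=(0)$ this set is empty and $t=0$). For a monomial $u$, $\mathrm{supp}(u)$ is the set of variables dividing $u$, with $\mathrm{supp}(1)=\emptyset$. *)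

theory Defs
  imports
    "HOL-Library.Poly_Mapping"
    "HOL-Algebra.Ideal_Product"
    "HOL-Algebra.Algebraic_Closure_Type"
begin

text \<open>
  Powers of ideals are taken in the library's multiplicative structure \<^const>\<open>ideals_set\<close>,
  whose unit is the carrier of the ring; hence the zeroth power of every ideal is the whole ring.
\<close>

definition demotion :: "('a, 'b) ring_scheme \<Rightarrow> 'a set \<Rightarrow> 'a set \<Rightarrow> bool" where
  "demotion R J I \<longleftrightarrow>
     ideal I R \<and> ideal J R \<and> J \<subseteq> I \<and>
     (\<forall>r s :: nat.
        (I [^]\<^bsub>ideals_set R\<^esub> r) \<cdot>\<^bsub>R\<^esub> (J [^]\<^bsub>ideals_set R\<^esub> s) =
        (I [^]\<^bsub>ideals_set R\<^esub> (r + s)) \<inter> (J [^]\<^bsub>ideals_set R\<^esub> s))"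

definition proper_demotion :: "('a, 'b) ring_scheme \<Rightarrow> 'a set \<Rightarrow> 'a set \<Rightarrow> bool" where
  "proper_demotion R J I \<longleftrightarrow> demotion R J I \<and> J \<noteq> I"

text \<open>
  \<open>('n, 'k) mpoly\<close> is the polynomial ring over \<open>'k\<close> in \<open>CARD('n)\<close> variables for a finite index
  type \<open>'n\<close>: a polynomial maps each exponent vector to its coefficient, and multiplication is
  the convolution product of \<^theory>\<open>HOL-Library.Poly_Mapping\<close>.
\<close>

type_synonym ('n, 'k) mpoly = "('n \<Rightarrow>\<^sub>0 nat) \<Rightarrow>\<^sub>0 'k"

abbreviation mpoly_ring :: "('n::finite, 'k::field) mpoly ring" where
  "mpoly_ring \<equiv> ring_of_type_algebra"

definition Var :: "'n::finite \<Rightarrow> ('n, 'k::field) mpoly" where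
  "Var i = Poly_Mapping.single (Poly_Mapping.single i 1) 1"

definition monomials :: "('n::finite, 'k::field) mpoly set" where
  "monomials = {\<Prod>i\<in>UNIV. Var i ^ a i | a. True}"

definition supp :: "('n::finite, 'k::field) mpoly \<Rightarrow> ('n, 'k) mpoly set" where
  "supp u = {x \<in> range Var. x dvd u}"

definition monomial_ideal :: "('n::finite, 'k::field) mpoly set \<Rightarrow> bool" where
  "monomial_ideal J \<longleftrightarrow> (\<exists>S \<subseteq> monomials. J = Idl\<^bsub>mpoly_ring\<^esub> S)"

text \<open>Minimality is with respect to inclusion; the set is meaningful for monomial ideals only.\<close>

definition min_monomial_gens :: "('n::finite, 'k::field) mpoly set \<Rightarrow> ('n, 'k) mpoly set" where
  "min_monomial_gens J =
     (THE G. G \<subseteq> monomials \<and> Idl\<^bsub>mpoly_ring\<^esub> G = J \<and> (\<forall>H. H \<subset> G \<longrightarrow> Idl\<^bsub>mpoly_ring\<^esub> H \<noteq> J))"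

end

theory Submission
  imports Defs
begin

text \<open>
  A monomial ideal is determined by the exponent vectors of its monomials: with \<open>multiples A\<close> the
  set of exponent vectors that lie coordinatewise above some vector in \<open>A\<close>, the ideal generated
  by the monomials with exponents in \<open>A\<close> consists of the polynomials whose monomials all have
  exponents in \<open>multiples A\<close> (\<open>Idl_xpow\<close>). Under this dictionary, sums of vectors correspond
  to products of ideals and intersections to intersections, so being a demotion becomes a statement
  about sets of exponent vectors (\<open>demotion_exponent_ideal_iff\<close>). Write \<open>\<alpha>\<close> for the exponent
  vector of \<open>m\<close>, and \<open>A\<close> for a set of exponent vectors generating \<open>J\<close>.

  Suppose that every \<open>a\<close> in \<open>A\<close> agrees with \<open>\<alpha>\<close> on the support of \<open>\<alpha>\<close>, which is to say that
  the cofactor \<open>u\<close> of the generator \<open>m u\<close> shares no variable with \<open>m\<close>. A sum \<open>v\<close> of \<open>s\<close> such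
  vectors equals \<open>s \<alpha>\<close> on that support. Hence a vector that dominates both \<open>(r + s) \<alpha>\<close> and \<open>v\<close>
  dominates \<open>r \<alpha> + v\<close>, which is \<open>(r + s) \<alpha>\<close> on the support and \<open>v\<close> off it; the other inclusion
  holds for any pair of ideals \<open>J \<subseteq> I\<close>. This is \<open>demotion_if_agree_on_support\<close>.

  Conversely, the instance \<open>r = s = 1\<close> already forces the agreement at every minimal generator
  \<open>a = \<alpha> + u\<close> (\<open>agree_on_support_if_demotion\<close>). If a variable \<open>x\<close> divides both \<open>m\<close> and
  the monomial \<open>u\<close>, then \<open>m (m u / x)\<close> is a multiple of \<open>m\<^sup>2\<close> and, since \<open>m / x\<close> is a monomial,
  also a multiple of \<open>m u\<close>. It lies in \<open>I\<^sup>2 \<inter> J = I J\<close>, so \<open>m u / x\<close> lies in \<open>J\<close>, contrary to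
  the minimality of \<open>m u\<close>.

  The minimal generators are the monomials whose exponents are the minimal elements of \<open>A\<close>
  (\<open>min_monomial_gens_exponent_ideal\<close>); they can be listed as \<open>m u\<^sub>1, \<dots>, m u\<^sub>t\<close> because, by
  Dickson's lemma, they are finite in number (\<open>finite_minimal_exps\<close>). For the existence of a
  proper demotion, a variable \<open>x\<close> not dividing \<open>m\<close> gives the ideal \<open>(m x)\<close>.
\<close>

section \<open>Ideals of the ring attached to a type\<close>

abbreviation (input) type_ring :: "'a::comm_ring_1 ring" where
  "type_ring \<equiv> ring_of_type_algebra"

lemma type_ring_simps [simp]:
  "carrier type_ring = UNIV" "x \<otimes>\<^bsub>type_ring\<^esub> y = x * y" "\<one>\<^bsub>type_ring\<^esub> = 1"
  "\<zero>\<^bsub>type_ring\<^esub> = 0" "x \<oplus>\<^bsub>type_ring\<^esub> y = x + y"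
  by (simp_all add: ring_of_type_algebra_def)

lemma ideal_type_ring_iff:
  fixes J :: "'a::comm_ring_1 set"
  shows "ideal J type_ring \<longleftrightarrow>
    0 \<in> J \<and> (\<forall>x\<in>J. \<forall>y\<in>J. x + y \<in> J) \<and> (\<forall>x. \<forall>y\<in>J. x * y \<in> J)"
proof -
  interpret R: cring "type_ring :: 'a ring" by (rule cring_from_type_algebra)
  show ?thesis
  proof (intro iffI conjI ballI allI)
    assume "ideal J type_ring"
    then interpret ideal J type_ring .
    show "0 \<in> J" using zero_closed by simp
    show "x + y \<in> J" if "x \<in> J" "y \<in> J" for x y using a_closed[OF that] by simp
    show "x * y \<in> J" if "y \<in> J" for x y using I_l_closed[OF that, of x] by simp
  next
    assume J: "0 \<in> J \<and> (\<forall>x\<in>J. \<forall>y\<in>J. x + y \<in> J) \<and> (\<forall>x. \<forall>y\<in>J. x * y \<in> J)"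
    have neg: "\<ominus>\<^bsub>type_ring\<^esub> x = - x" for x :: 'a
      by (rule R.minus_equality) simp_all
    show "ideal J type_ring"
    proof (rule idealI)
      show "ring (type_ring :: 'a ring)" by (rule ring_from_type_algebra)
      show "subgroup J (add_monoid type_ring)"
      proof (rule R.add.subgroupI)
        fix x assume "x \<in> J"
        then have "(-1) * x \<in> J" using J by blast
        then show "\<ominus>\<^bsub>type_ring\<^esub> x \<in> J" by (simp add: neg)
      qed (use J in auto)
      show "x \<otimes>\<^bsub>type_ring\<^esub> y \<in> J" if "y \<in> J" for x y using J that by simp
      show "y \<otimes>\<^bsub>type_ring\<^esub> x \<in> J" if "y \<in> J" for x y
        using J that by (simp add: mult.commute[of y])
    qed
  qed
qed

section \<open>Divisibility of exponent vectors\<close>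

abbreviation (input) "lookup \<equiv> Poly_Mapping.lookup"
abbreviation (input) "keys \<equiv> Poly_Mapping.keys"

definition exp_le :: "('n \<Rightarrow>\<^sub>0 nat) \<Rightarrow> ('n \<Rightarrow>\<^sub>0 nat) \<Rightarrow> bool" (infix "\<preceq>" 50) where
  "a \<preceq> b \<longleftrightarrow> (\<forall>i. lookup a i \<le> lookup b i)"

definition multiples :: "('n \<Rightarrow>\<^sub>0 nat) set \<Rightarrow> ('n \<Rightarrow>\<^sub>0 nat) set" where
  "multiples A = {b. \<exists>a\<in>A. a \<preceq> b}"

definition minimal_exps :: "('n \<Rightarrow>\<^sub>0 nat) set \<Rightarrow> ('n \<Rightarrow>\<^sub>0 nat) set" where
  "minimal_exps A = {a \<in> A. \<forall>b\<in>A. b \<preceq> a \<longrightarrow> b = a}"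

lemma exp_le_refl [simp]: "a \<preceq> a"
  by (simp add: exp_le_def)

lemma exp_le_trans: "a \<preceq> b \<Longrightarrow> b \<preceq> c \<Longrightarrow> a \<preceq> c"
  by (meson exp_le_def order_trans)

lemma exp_le_antisym: "a \<preceq> b \<Longrightarrow> b \<preceq> a \<Longrightarrow> a = b"
  by (meson exp_le_def order_antisym poly_mapping_eqI)

lemma exp_le_iff_add: "a \<preceq> b \<longleftrightarrow> (\<exists>c. b = a + c)"
proof
  assume "a \<preceq> b"
  then have "b = a + (b - a)"
    by (intro poly_mapping_eqI) (simp add: exp_le_def lookup_add lookup_minus)
  then show "\<exists>c. b = a + c" ..
qed (auto simp: exp_le_def lookup_add)

lemma in_multiples: "a \<in> A \<Longrightarrow> a \<in> multiples A"
  unfolding multiples_def using exp_le_refl by blast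

lemma multiples_add: "b \<in> multiples A \<Longrightarrow> b + c \<in> multiples A"
  by (force simp: multiples_def exp_le_def lookup_add intro: trans_le_add1)

text \<open>Passing to a proper divisor lowers the total degree, so the descent in \<open>A\<close> ends.\<close>

lemma ex_minimal_exps_le:
  fixes a :: "'n::finite \<Rightarrow>\<^sub>0 nat"
  assumes "a \<in> A"
  shows "\<exists>b\<in>minimal_exps A. b \<preceq> a"
  using assms
proof (induction "\<Sum>i\<in>UNIV. lookup a i" arbitrary: a rule: less_induct)
  case less
  show ?case
  proof (cases "a \<in> minimal_exps A")
    case False
    then obtain b where b: "b \<in> A" "b \<preceq> a" "b \<noteq> a"
      using less.prems by (auto simp: minimal_exps_def)
    then obtain i where "lookup b i \<noteq> lookup a i"
      by (meson poly_mapping_eqI)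
    then have "(\<Sum>i\<in>UNIV. lookup b i) < (\<Sum>i\<in>UNIV. lookup a i)"
      using b(2) by (intro sum_strict_mono_ex1) (auto simp: exp_le_def intro!: exI[of _ i] le_neq_trans)
    from less.hyps[OF this b(1)] show ?thesis
      using b(2) exp_le_trans by blast
  qed (use exp_le_refl in blast)
qed

lemma multiples_minimal_exps:
  fixes A :: "('n::finite \<Rightarrow>\<^sub>0 nat) set"
  shows "multiples (minimal_exps A) = multiples A"
proof
  show "multiples (minimal_exps A) \<subseteq> multiples A"
    by (auto simp: multiples_def minimal_exps_def)
  show "multiples A \<subseteq> multiples (minimal_exps A)"
  proof
    fix c assume "c \<in> multiples A"
    then obtain a where a: "a \<in> A" "a \<preceq> c" by (auto simp: multiples_def)
    obtain b where "b \<in> minimal_exps A" "b \<preceq> a" using ex_minimal_exps_le[OF a(1)] ..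
    then show "c \<in> multiples (minimal_exps A)"
      using exp_le_trans[of b a c] a(2) by (auto simp: multiples_def)
  qed
qed

text \<open>
  This yields both uniqueness and irredundancy of the minimal generators: a generating set can
  neither avoid nor shrink below the minimal elements, since a generator dividing \<open>a\<close> is itself
  divisible by an element of \<open>A\<close>.
\<close>

lemma minimal_exps_subset:
  assumes "multiples B = multiples A"
  shows "minimal_exps A \<subseteq> B"
proof
  fix a assume a: "a \<in> minimal_exps A"
  then have "a \<in> multiples B"
    unfolding assms by (simp add: minimal_exps_def in_multiples)
  then obtain b where b: "b \<in> B" "b \<preceq> a" by (auto simp: multiples_def)
  then have "b \<in> multiples A"
    unfolding assms[symmetric] by (simp add: in_multiples)
  then obtain a' where a': "a' \<in> A" "a' \<preceq> b" by (auto simp: multiples_def)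
  then have "a' = a"
    using a b(2) exp_le_trans by (auto simp: minimal_exps_def)
  then have "a = b"
    using a'(2) b(2) exp_le_antisym by blast
  then show "a \<in> B" using b(1) by simp
qed

text \<open>
  The combinatorial core of Dickson's lemma. Coordinates are treated one at a time: every sequence
  has a monotone subsequence, and a decreasing sequence of natural numbers is constant from some
  index on, so after dropping finitely many terms the subsequence is increasing.
\<close>

lemma ex_coordinatewise_mono_subseq:
  fixes f :: "nat \<Rightarrow> 'i \<Rightarrow> nat"
  assumes "finite V"
  shows "\<exists>g :: nat \<Rightarrow> nat. strict_mono g \<and> (\<forall>i\<in>V. mono (\<lambda>n. f (g n) i))"
  using assms
proof (induction V rule: finite_induct)
  case empty
  show ?case by (intro exI[of _ id]) (simp add: strict_mono_def)
next
  case (insert j V)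
  then obtain g :: "nat \<Rightarrow> nat" where g: "strict_mono g" "\<And>i. i \<in> V \<Longrightarrow> mono (\<lambda>n. f (g n) i)" by auto
  obtain h :: "nat \<Rightarrow> nat" where h: "strict_mono h" "monoseq (\<lambda>n. f (g (h n)) j)"
    using seq_monosub[of "\<lambda>n. f (g n) j"] by auto
  have "\<exists>k. mono (\<lambda>n. f (g (h (k + n))) j)"
  proof (cases "incseq (\<lambda>n. f (g (h n)) j)")
    case True
    then show ?thesis by (intro exI[of _ 0]) (simp add: mono_def)
  next
    case False
    then have dec: "f (g (h n)) j \<le> f (g (h m)) j" if "m \<le> n" for m n
      using h(2) that by (auto simp: monoseq_iff decseq_def)
    define v where "v = (LEAST x. x \<in> range (\<lambda>n. f (g (h n)) j))"
    have "v \<in> range (\<lambda>n. f (g (h n)) j)"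
      unfolding v_def by (rule LeastI) (rule rangeI)
    then obtain k where k: "v = f (g (h k)) j" by blast
    have "f (g (h (k + n))) j = v" for n
      using dec[of k "k + n"] k Least_le[of "\<lambda>x. x \<in> range (\<lambda>n. f (g (h n)) j)" "f (g (h (k + n))) j"]
      by (simp add: v_def)
    then show ?thesis by (intro exI[of _ k]) (simp add: mono_def)
  qed
  then obtain k where k: "mono (\<lambda>n. f (g (h (k + n))) j)" ..
  let ?g = "\<lambda>n. g (h (k + n))"
  have "strict_mono ?g"
    using g(1) h(1) by (auto simp: strict_mono_def)
  moreover have "mono (\<lambda>n. f (?g n) i)" if "i \<in> insert j V" for i
  proof (cases "i = j")
    case False
    then have "mono (\<lambda>n. f (g n) i)" using that g(2) by auto
    then show ?thesis
      using h(1) by (auto simp: mono_def strict_mono_less_eq)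
  qed (use k in simp)
  ultimately show ?case by blast
qed

text \<open>
  Dickson's lemma: in a sequence of distinct minimal vectors, a coordinatewise increasing
  subsequence would contain two different comparable ones.
\<close>

lemma finite_minimal_exps:
  fixes A :: "('n::finite \<Rightarrow>\<^sub>0 nat) set"
  shows "finite (minimal_exps A)"
proof (rule ccontr)
  assume "infinite (minimal_exps A)"
  then obtain f :: "nat \<Rightarrow> 'n \<Rightarrow>\<^sub>0 nat" where f: "inj f" "range f \<subseteq> minimal_exps A"
    using infinite_countable_subset by blast
  obtain g :: "nat \<Rightarrow> nat" where g: "strict_mono g" "\<And>i. mono (\<lambda>n. lookup (f (g n)) i)"
    using ex_coordinatewise_mono_subseq[of UNIV "\<lambda>n. lookup (f n)"] by auto
  have "f (g 0) \<preceq> f (g 1)"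
    unfolding exp_le_def using monoD[OF g(2), of 0 1] by simp
  moreover have "f (g 0) \<in> minimal_exps A" "f (g 1) \<in> minimal_exps A"
    using f(2) by auto
  ultimately have "f (g 0) = f (g 1)"
    by (auto simp: minimal_exps_def)
  then have "g 0 = g 1" using f(1) by (simp add: inj_eq)
  then show False using g(1) by (simp add: strict_mono_eq)
qed

section \<open>Monomial ideals as sets of exponent vectors\<close>

abbreviation xpow :: "('n::finite \<Rightarrow>\<^sub>0 nat) \<Rightarrow> ('n, 'k::field) mpoly" where
  "xpow a \<equiv> Poly_Mapping.single a 1"

definition exponent_ideal :: "('n::finite \<Rightarrow>\<^sub>0 nat) set \<Rightarrow> ('n, 'k::field) mpoly set" where
  "exponent_ideal A = {p. keys p \<subseteq> multiples A}"

lemma inj_xpow: "inj (xpow :: _ \<Rightarrow> ('n::finite, 'k::field) mpoly)"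
proof (rule injI)
  fix a b assume "(xpow a :: ('n, 'k) mpoly) = xpow b"
  then have "keys (xpow a :: ('n, 'k) mpoly) = keys (xpow b :: ('n, 'k) mpoly)"
    by (rule arg_cong)
  then show "a = b" by simp
qed

lemma xpow_add: "xpow (a + b) = xpow a * xpow b"
  by (simp add: mult_single)

lemma xpow_in_exponent_ideal_iff [simp]: "xpow b \<in> exponent_ideal A \<longleftrightarrow> b \<in> multiples A"
  by (simp add: exponent_ideal_def)

lemma exponent_ideal_eq_iff:
  "(exponent_ideal A :: ('n::finite, 'k::field) mpoly set) = exponent_ideal B \<longleftrightarrow>
    multiples A = multiples B"
proof
  assume "(exponent_ideal A :: ('n, 'k) mpoly set) = exponent_ideal B"
  then have "b \<in> multiples A \<longleftrightarrow> b \<in> multiples B" for b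
    by (metis xpow_in_exponent_ideal_iff)
  then show "multiples A = multiples B" by blast
qed (simp add: exponent_ideal_def)

lemma ideal_exponent_ideal:
  "ideal (exponent_ideal A :: ('n::finite, 'k::field) mpoly set) mpoly_ring"
  unfolding ideal_type_ring_iff
proof (intro conjI ballI allI)
  show "0 \<in> exponent_ideal A" by (simp add: exponent_ideal_def)
next
  fix p q :: "('n, 'k) mpoly" assume "p \<in> exponent_ideal A" "q \<in> exponent_ideal A"
  then show "p + q \<in> exponent_ideal A"
    using Poly_Mapping.keys_add[of p q] by (auto simp: exponent_ideal_def)
next
  fix p q :: "('n, 'k) mpoly" assume q: "q \<in> exponent_ideal A"
  show "p * q \<in> exponent_ideal A"
    unfolding exponent_ideal_def
  proof (intro CollectI subsetI)
    fix c assume "c \<in> keys (p * q)"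
    then obtain a b where "c = a + b" "b \<in> keys q"
      using keys_mult[of p q] by blast
    moreover from this have "b + a \<in> multiples A"
      using q by (intro multiples_add) (auto simp: exponent_ideal_def)
    ultimately show "c \<in> multiples A" by (simp add: add.commute)
  qed
qed

text \<open>
  Every term \<open>k x\<^sup>c\<close> of a polynomial in \<open>exponent_ideal A\<close> is a multiple of a generator, and the
  polynomial is the sum of its terms.
\<close>

lemma exponent_ideal_least:
  fixes J :: "('n::finite, 'k::field) mpoly set"
  assumes J: "ideal J mpoly_ring" and A: "xpow ` A \<subseteq> J"
  shows "exponent_ideal A \<subseteq> J"
proof
  fix p :: "('n, 'k) mpoly" assume p: "p \<in> exponent_ideal A"
  have "Poly_Mapping.single c (lookup p c) \<in> J" if "c \<in> keys p" for c
  proof -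
    obtain a b where ab: "a \<in> A" "c = a + b"
      using p \<open>c \<in> keys p\<close> by (auto simp: exponent_ideal_def multiples_def exp_le_iff_add)
    have "Poly_Mapping.single c (lookup p c) = Poly_Mapping.single b (lookup p c) * xpow a"
      by (simp add: mult_single ab(2) add.commute)
    also have "\<dots> \<in> J"
      using J A ab(1) unfolding ideal_type_ring_iff by blast
    finally show ?thesis .
  qed
  moreover have "sum h S \<in> J" if "finite S" "\<And>c. c \<in> S \<Longrightarrow> h c \<in> J"
    for S :: "('n \<Rightarrow>\<^sub>0 nat) set" and h
    using that J by (induction S rule: finite_induct) (auto simp: ideal_type_ring_iff)
  ultimately have "(\<Sum>c\<in>keys p. Poly_Mapping.single c (lookup p c)) \<in> J" by simp
  moreover have "(\<Sum>c\<in>keys p. Poly_Mapping.single c (lookup p c)) = p"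
    by (rule poly_mapping_eqI)
      (auto simp: lookup_sum lookup_single when_def in_keys_iff)
  ultimately show "p \<in> J" by simp
qed

lemma Idl_xpow: "Idl\<^bsub>mpoly_ring\<^esub> (xpow ` A) = exponent_ideal A"
proof
  interpret R: cring "mpoly_ring :: ('n::finite, 'k::field) mpoly ring"
    by (rule cring_from_type_algebra)
  have "xpow ` A \<subseteq> exponent_ideal A"
    by (auto intro: in_multiples)
  then show "Idl\<^bsub>mpoly_ring\<^esub> (xpow ` A) \<subseteq> exponent_ideal A"
    by (intro R.genideal_minimal ideal_exponent_ideal)
  show "exponent_ideal A \<subseteq> Idl\<^bsub>mpoly_ring\<^esub> (xpow ` A)"
    by (intro exponent_ideal_least R.genideal_ideal R.genideal_self) simp_all
qed

definition sumset :: "('n \<Rightarrow>\<^sub>0 nat) set \<Rightarrow> ('n \<Rightarrow>\<^sub>0 nat) set \<Rightarrow> ('n \<Rightarrow>\<^sub>0 nat) set" where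
  "sumset A B = {a + b | a b. a \<in> A \<and> b \<in> B}"

text \<open>The value \<open>{0}\<close> at \<open>0\<close> matches the convention that the zeroth power of an ideal is the ring.\<close>

primrec sumset_pow :: "('n \<Rightarrow>\<^sub>0 nat) set \<Rightarrow> nat \<Rightarrow> ('n \<Rightarrow>\<^sub>0 nat) set" where
  "sumset_pow A 0 = {0}"
| "sumset_pow A (Suc s) = sumset (sumset_pow A s) A"

lemma ideal_prod_exponent_ideal:
  "exponent_ideal A \<cdot>\<^bsub>mpoly_ring\<^esub> exponent_ideal B =
    (exponent_ideal (sumset A B) :: ('n::finite, 'k::field) mpoly set)"
proof
  interpret R: cring "mpoly_ring :: ('n, 'k) mpoly ring"
    by (rule cring_from_type_algebra)
  have ideal_sum: "ideal (exponent_ideal (sumset A B) :: ('n, 'k) mpoly set) mpoly_ring"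
    by (rule ideal_exponent_ideal)
  have closed: "p + q \<in> exponent_ideal (sumset A B)"
    if "p \<in> exponent_ideal (sumset A B)" "q \<in> exponent_ideal (sumset A B)"
    for p q :: "('n, 'k) mpoly"
    using ideal_sum that unfolding ideal_type_ring_iff by blast
  have mult: "p * q \<in> exponent_ideal (sumset A B)"
    if p: "p \<in> exponent_ideal A" and q: "q \<in> exponent_ideal B" for p q :: "('n, 'k) mpoly"
    unfolding exponent_ideal_def
  proof (intro CollectI subsetI)
    fix c assume "c \<in> keys (p * q)"
    then obtain a' b' where c: "c = a' + b'" "a' \<in> keys p" "b' \<in> keys q"
      using keys_mult[of p q] by blast
    then obtain a a'' b b'' where ab: "a \<in> A" "b \<in> B" "a' = a + a''" "b' = b + b''"
      using p q unfolding exponent_ideal_def multiples_def exp_le_iff_add by blast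
    have "a + b \<in> multiples (sumset A B)"
      using ab(1,2) by (intro in_multiples) (auto simp: sumset_def)
    from multiples_add[OF this, of "a'' + b''"] show "c \<in> multiples (sumset A B)"
      by (simp add: c(1) ab(3,4) ac_simps)
  qed
  show "exponent_ideal A \<cdot>\<^bsub>mpoly_ring\<^esub> exponent_ideal B
      \<subseteq> (exponent_ideal (sumset A B) :: ('n, 'k) mpoly set)"
  proof
    fix p :: "('n, 'k) mpoly" assume "p \<in> exponent_ideal A \<cdot>\<^bsub>mpoly_ring\<^esub> exponent_ideal B"
    then show "p \<in> exponent_ideal (sumset A B)"
      by induction (auto intro: mult closed)
  qed
  have "xpow c \<in> exponent_ideal A \<cdot>\<^bsub>mpoly_ring\<^esub> (exponent_ideal B :: ('n, 'k) mpoly set)"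
    if "c \<in> sumset A B" for c
  proof -
    obtain a b where ab: "a \<in> A" "b \<in> B" "c = a + b"
      using \<open>c \<in> sumset A B\<close> by (auto simp: sumset_def)
    then have "xpow a \<in> exponent_ideal A" "xpow b \<in> exponent_ideal B"
      by (simp_all add: in_multiples)
    from ideal_prod.prod[OF this, of mpoly_ring] show ?thesis
      by (simp add: ab(3) xpow_add)
  qed
  then show "exponent_ideal (sumset A B)
      \<subseteq> exponent_ideal A \<cdot>\<^bsub>mpoly_ring\<^esub> (exponent_ideal B :: ('n, 'k) mpoly set)"
    by (intro exponent_ideal_least R.ideal_prod_is_ideal ideal_exponent_ideal) auto
qed

lemma ideal_pow_exponent_ideal:
  "exponent_ideal A [^]\<^bsub>ideals_set mpoly_ring\<^esub> s =
    (exponent_ideal (sumset_pow A s) :: ('n::finite, 'k::field) mpoly set)"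
proof (induction s)
  case 0
  have "multiples {0} = (UNIV :: ('n \<Rightarrow>\<^sub>0 nat) set)"
    by (auto simp: multiples_def exp_le_def)
  then show ?case
    by (simp add: nat_pow_def ideals_set_def exponent_ideal_def)
next
  case (Suc s)
  then show ?case
    by (simp add: nat_pow_def ideals_set_def ideal_prod_exponent_ideal)
qed

section \<open>Demotions of a principal monomial ideal\<close>

lemma demotion_exponent_ideal_iff:
  "demotion mpoly_ring (exponent_ideal A) (exponent_ideal B :: ('n::finite, 'k::field) mpoly set)
    \<longleftrightarrow> multiples A \<subseteq> multiples B \<and>
      (\<forall>r s. multiples (sumset (sumset_pow B r) (sumset_pow A s)) =
             multiples (sumset_pow B (r + s)) \<inter> multiples (sumset_pow A s))"
proof -
  have sub: "(exponent_ideal A :: ('n, 'k) mpoly set) \<subseteq> exponent_ideal B \<longleftrightarrow>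
      multiples A \<subseteq> multiples B" for A B :: "('n \<Rightarrow>\<^sub>0 nat) set"
  proof
    assume *: "(exponent_ideal A :: ('n, 'k) mpoly set) \<subseteq> exponent_ideal B"
    show "multiples A \<subseteq> multiples B"
    proof
      fix b assume "b \<in> multiples A"
      then have "(xpow b :: ('n, 'k) mpoly) \<in> exponent_ideal A" by simp
      with * have "(xpow b :: ('n, 'k) mpoly) \<in> exponent_ideal B" by blast
      then show "b \<in> multiples B" by simp
    qed
  qed (auto simp: exponent_ideal_def)
  have int: "(exponent_ideal A :: ('n, 'k) mpoly set) = exponent_ideal B \<inter> exponent_ideal C \<longleftrightarrow>
      multiples A = multiples B \<inter> multiples C" for A B C :: "('n \<Rightarrow>\<^sub>0 nat) set"
  proof
    assume *: "(exponent_ideal A :: ('n, 'k) mpoly set) = exponent_ideal B \<inter> exponent_ideal C"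
    have "b \<in> multiples A \<longleftrightarrow> b \<in> multiples B \<inter> multiples C" for b
    proof -
      have "(xpow b :: ('n, 'k) mpoly) \<in> exponent_ideal A \<longleftrightarrow>
          (xpow b :: ('n, 'k) mpoly) \<in> exponent_ideal B \<inter> exponent_ideal C"
        unfolding * ..
      then show ?thesis by simp
    qed
    then show "multiples A = multiples B \<inter> multiples C" by blast
  qed (auto simp: exponent_ideal_def)
  show ?thesis
    by (simp add: demotion_def ideal_exponent_ideal ideal_pow_exponent_ideal
        ideal_prod_exponent_ideal sub int)
qed

lemma lookup_sumset_pow:
  assumes "\<And>a. a \<in> A \<Longrightarrow> lookup a i = k" and "v \<in> sumset_pow A s"
  shows "lookup v i = s * k"
  using assms(2)
  by (induction s arbitrary: v) (auto simp: sumset_def lookup_add assms(1))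

lemma ex_sumset_pow_singleton: "\<exists>c. sumset_pow {b} s = {c}"
  by (induction s) (auto simp: sumset_def)

text \<open>
  At a coordinate in the support of \<open>\<alpha>\<close> all elements of \<open>sumset_pow A s\<close> have the entry
  \<open>s \<alpha>\<^sub>i\<close>, and at any other coordinate the powers of \<open>I\<close> impose no condition. So \<open>r \<alpha> + v \<preceq> w\<close> is
  equivalent to \<open>(r + s) \<alpha> \<preceq> w\<close> together with \<open>v \<preceq> w\<close>.
\<close>

lemma demotion_if_agree_on_support:
  assumes agree: "\<And>a i. a \<in> A \<Longrightarrow> lookup \<alpha> i > 0 \<Longrightarrow> lookup a i = lookup \<alpha> i"
  shows "demotion mpoly_ring (exponent_ideal A)
    (exponent_ideal {\<alpha>} :: ('n::finite, 'k::field) mpoly set)"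
  unfolding demotion_exponent_ideal_iff
proof (intro conjI allI)
  have "\<alpha> \<preceq> a" if "a \<in> A" for a
    unfolding exp_le_def using agree[OF that] by (metis le_eq_less_or_eq neq0_conv zero_le)
  then show "multiples A \<subseteq> multiples {\<alpha>}"
    by (auto simp: multiples_def intro: exp_le_trans)
next
  fix r s
  obtain b where b: "sumset_pow {\<alpha>} r = {b}" using ex_sumset_pow_singleton by blast
  obtain c where c: "sumset_pow {\<alpha>} (r + s) = {c}" using ex_sumset_pow_singleton by blast
  have lb: "lookup b i = r * lookup \<alpha> i" for i
    using b by (intro lookup_sumset_pow[of "{\<alpha>}"]) auto
  have lc: "lookup c i = (r + s) * lookup \<alpha> i" for i
    using c by (intro lookup_sumset_pow[of "{\<alpha>}"]) auto
  have le: "b + v \<preceq> w \<longleftrightarrow> c \<preceq> w \<and> v \<preceq> w" if "v \<in> sumset_pow A s" for v w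
  proof -
    have "lookup (b + v) i \<le> lookup w i \<longleftrightarrow> lookup c i \<le> lookup w i \<and> lookup v i \<le> lookup w i" for i
    proof (cases "lookup \<alpha> i = 0")
      case False
      then have "lookup v i = s * lookup \<alpha> i"
        by (intro lookup_sumset_pow[OF _ that] agree) auto
      then show ?thesis by (auto simp: lookup_add lb lc algebra_simps)
    qed (simp add: lookup_add lb lc)
    then show ?thesis by (auto simp: exp_le_def)
  qed
  show "multiples (sumset (sumset_pow {\<alpha>} r) (sumset_pow A s)) =
      multiples (sumset_pow {\<alpha>} (r + s)) \<inter> multiples (sumset_pow A s)"
    unfolding b c
    using le by (fastforce simp: multiples_def sumset_def)
qed

text \<open>
  If \<open>a\<close> exceeds \<open>\<alpha>\<close> at a coordinate \<open>i\<close> of the support of \<open>\<alpha>\<close>, then \<open>a + \<alpha> - e\<^sub>i\<close> still dominates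
  both \<open>2 \<alpha>\<close> and \<open>a\<close>. The demotion property for \<open>r = s = 1\<close> then provides an element of \<open>A\<close>
  below \<open>a - e\<^sub>i\<close>, so \<open>a\<close> is not minimal.
\<close>

lemma agree_on_support_if_demotion:
  assumes dem: "demotion mpoly_ring (exponent_ideal A)
      (exponent_ideal {\<alpha>} :: ('n::finite, 'k::field) mpoly set)"
    and a: "a \<in> minimal_exps A" and i: "lookup \<alpha> i > 0"
  shows "lookup a i = lookup \<alpha> i"
proof (rule ccontr)
  assume neq: "lookup a i \<noteq> lookup \<alpha> i"
  have aA: "a \<in> A" using a by (simp add: minimal_exps_def)
  then have "a \<in> multiples A" by (rule in_multiples)
  then have le: "\<alpha> \<preceq> a"
    using dem unfolding demotion_exponent_ideal_iff by (auto simp: multiples_def)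
  then have gt: "lookup \<alpha> i < lookup a i"
    using neq by (simp add: exp_le_def le_neq_trans)
  let ?e = "Poly_Mapping.single i 1 :: 'n \<Rightarrow>\<^sub>0 nat"
  define w where "w = a + (\<alpha> - ?e)"
  have lw: "lookup w j = (if j = i then lookup a i + lookup \<alpha> i - 1
      else lookup a j + lookup \<alpha> j)" for j
    using i by (simp add: w_def lookup_add lookup_minus lookup_single when_def)
  have "a \<preceq> w" by (auto simp: w_def exp_le_iff_add)
  moreover have "\<alpha> + \<alpha> \<preceq> w"
    unfolding exp_le_def
  proof
    fix j
    show "lookup (\<alpha> + \<alpha>) j \<le> lookup w j"
      using le gt unfolding exp_le_def by (auto simp: lw lookup_add)
  qed
  ultimately have "w \<in> multiples (sumset_pow {\<alpha>} (1 + 1)) \<inter> multiples (sumset_pow A 1)"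
    using aA by (auto simp: multiples_def sumset_def)
  also have "\<dots> = multiples (sumset (sumset_pow {\<alpha>} 1) (sumset_pow A 1))"
    using dem unfolding demotion_exponent_ideal_iff by blast
  finally obtain b where b: "b \<in> A" "\<alpha> + b \<preceq> w"
    by (auto simp: multiples_def sumset_def)
  have b_le: "lookup b j \<le> (if j = i then lookup a i - 1 else lookup a j)" for j
  proof -
    have "lookup \<alpha> j + lookup b j \<le> lookup w j"
      using b(2) by (simp add: exp_le_def lookup_add)
    then show ?thesis using gt by (auto simp: lw split: if_splits)
  qed
  have "b \<preceq> a"
    unfolding exp_le_def
  proof
    fix j show "lookup b j \<le> lookup a j" using b_le[of j] by (auto split: if_splits)
  qed
  then have "b = a" using a b(1) by (simp add: minimal_exps_def)
  then show False using b_le[of i] gt by simp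
qed

section \<open>Monomials, supports and minimal generators\<close>

lemma prod_Var_power:
  "(\<Prod>i\<in>UNIV. Var i ^ a i :: ('n::finite, 'k::field) mpoly) = xpow (Abs_poly_mapping a)"
proof -
  have pow: "(Var i ^ k :: ('n, 'k) mpoly) = xpow (Poly_Mapping.single i k)" for i k
    by (induction k) (simp_all add: Var_def mult_single flip: single_add)
  have "(\<Prod>i\<in>S. Var i ^ a i :: ('n, 'k) mpoly) = xpow (\<Sum>i\<in>S. Poly_Mapping.single i (a i))"
    if "finite S" for S
    using that by (induction S rule: finite_induct) (simp_all add: pow mult_single)
  moreover have "(\<Sum>i\<in>UNIV. Poly_Mapping.single i (a i)) = Abs_poly_mapping a"
    by (rule poly_mapping_eqI)
      (simp add: lookup_sum lookup_single when_def)
  ultimately show ?thesis by simp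
qed

lemma monomials_eq: "monomials = range xpow"
proof -
  have "xpow b = (\<Prod>i\<in>UNIV. Var i ^ lookup b i)" for b
    by (simp add: prod_Var_power)
  then show ?thesis
    unfolding monomials_def using prod_Var_power by blast
qed

lemma supp_xpow: "supp (xpow a :: ('n::finite, 'k::field) mpoly) = Var ` {i. lookup a i > 0}"
proof -
  have "Var i dvd (xpow a :: ('n, 'k) mpoly) \<longleftrightarrow> lookup a i > 0" for i
  proof
    assume "Var i dvd (xpow a :: ('n, 'k) mpoly)"
    then obtain q where "(xpow a :: ('n, 'k) mpoly) = Var i * q" by auto
    then have "a \<in> keys (Var i * q)" by (metis keys_single one_neq_zero singletonI)
    then obtain c where "a = Poly_Mapping.single i 1 + c"
      using keys_mult[of "Var i" q] by (auto simp: Var_def)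
    then show "lookup a i > 0" by (simp add: lookup_add)
  next
    assume "lookup a i > 0"
    then have "Poly_Mapping.single i 1 \<preceq> a"
      by (auto simp: exp_le_def lookup_single when_def)
    then obtain c where "a = Poly_Mapping.single i 1 + c"
      by (auto simp: exp_le_iff_add)
    then show "Var i dvd (xpow a :: ('n, 'k) mpoly)"
      by (simp add: xpow_add Var_def)
  qed
  then show ?thesis by (auto simp: supp_def)
qed

lemma inj_Var: "inj (Var :: 'n::finite \<Rightarrow> ('n, 'k::field) mpoly)"
proof (rule injI)
  fix i j assume "(Var i :: ('n, 'k) mpoly) = Var j"
  then have "Poly_Mapping.single i (1 :: nat) = Poly_Mapping.single j 1"
    unfolding Var_def by (rule injD[OF inj_xpow])
  then have "keys (Poly_Mapping.single i (1 :: nat)) = keys (Poly_Mapping.single j (1 :: nat))"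
    by (rule arg_cong)
  then show "i = j" by simp
qed

lemma supp_disjoint_iff:
  "supp (xpow a :: ('n::finite, 'k::field) mpoly) \<inter> supp (xpow b :: ('n, 'k) mpoly) = {} \<longleftrightarrow>
    (\<forall>i. lookup b i > 0 \<longrightarrow> lookup a i = 0)"
proof -
  have "supp (xpow a :: ('n, 'k) mpoly) \<inter> supp (xpow b) =
      Var ` ({i. lookup a i > 0} \<inter> {i. lookup b i > 0})"
    unfolding supp_xpow by (rule image_Int[OF inj_Var, symmetric])
  then have "supp (xpow a :: ('n, 'k) mpoly) \<inter> supp (xpow b) = {} \<longleftrightarrow>
      {i. lookup a i > 0} \<inter> {i. lookup b i > 0} = {}"
    by (simp only: image_is_empty)
  also have "\<dots> \<longleftrightarrow> (\<forall>i. lookup b i > 0 \<longrightarrow> lookup a i = 0)"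
    unfolding disjoint_iff mem_Collect_eq by (metis gr0I less_numeral_extra(3))
  finally show ?thesis .
qed

lemma Idl_minimal_exps:
  "Idl\<^bsub>mpoly_ring\<^esub> (xpow ` minimal_exps A) = (exponent_ideal A :: ('n::finite, 'k::field) mpoly set)"
  unfolding Idl_xpow exponent_ideal_eq_iff by (rule multiples_minimal_exps)

lemma min_monomial_gens_exponent_ideal:
  "min_monomial_gens (exponent_ideal A :: ('n::finite, 'k::field) mpoly set) =
    xpow ` minimal_exps A"
  unfolding min_monomial_gens_def
proof (rule the_equality)
  let ?M = "xpow ` minimal_exps A :: ('n, 'k) mpoly set"
  show "?M \<subseteq> monomials \<and> Idl\<^bsub>mpoly_ring\<^esub> ?M = exponent_ideal A \<and>
      (\<forall>H. H \<subset> ?M \<longrightarrow> Idl\<^bsub>mpoly_ring\<^esub> H \<noteq> exponent_ideal A)"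
  proof (intro conjI allI impI)
    show "?M \<subseteq> monomials"
      unfolding monomials_eq by (rule image_mono) simp
    show "Idl\<^bsub>mpoly_ring\<^esub> ?M = exponent_ideal A"
      by (rule Idl_minimal_exps)
    fix H :: "('n, 'k) mpoly set" assume H: "H \<subset> xpow ` minimal_exps A"
    then obtain C where C: "C \<subseteq> minimal_exps A" "H = xpow ` C"
      by (meson psubset_imp_subset subset_imageE)
    have "\<not> minimal_exps A \<subseteq> C" using C H by blast
    then have "multiples C \<noteq> multiples A" using minimal_exps_subset by blast
    then show "Idl\<^bsub>mpoly_ring\<^esub> H \<noteq> exponent_ideal A"
      unfolding C(2) Idl_xpow exponent_ideal_eq_iff .
  qed
next
  fix G :: "('n, 'k) mpoly set"
  assume G: "G \<subseteq> monomials \<and> Idl\<^bsub>mpoly_ring\<^esub> G = exponent_ideal A \<and>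
      (\<forall>H. H \<subset> G \<longrightarrow> Idl\<^bsub>mpoly_ring\<^esub> H \<noteq> exponent_ideal A)"
  then obtain B where B: "G = xpow ` B"
    unfolding monomials_eq by (meson subset_imageE)
  then have "multiples B = multiples A"
    using G by (simp add: Idl_xpow exponent_ideal_eq_iff)
  then have "xpow ` minimal_exps A \<subseteq> G"
    unfolding B by (intro image_mono minimal_exps_subset)
  moreover have "Idl\<^bsub>mpoly_ring\<^esub> (xpow ` minimal_exps A) = (exponent_ideal A :: ('n, 'k) mpoly set)"
    by (rule Idl_minimal_exps)
  then have "\<not> xpow ` minimal_exps A \<subset> G"
    using G by metis
  ultimately show "G = xpow ` minimal_exps A"
    by (simp add: psubset_eq)
qed

lemma PIdl_xpow:
  "PIdl\<^bsub>mpoly_ring\<^esub> (xpow \<alpha>) = (exponent_ideal {\<alpha>} :: ('n::finite, 'k::field) mpoly set)"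
proof -
  interpret R: cring "mpoly_ring :: ('n, 'k) mpoly ring"
    by (rule cring_from_type_algebra)
  have "PIdl\<^bsub>mpoly_ring\<^esub> (xpow \<alpha>) =
      (Idl\<^bsub>mpoly_ring\<^esub> {xpow \<alpha>} :: ('n, 'k) mpoly set)"
    by (rule R.cgenideal_eq_genideal) (simp only: type_ring_simps UNIV_I)
  also have "\<dots> = exponent_ideal {\<alpha>}"
    using Idl_xpow[of "{\<alpha>}"] by (simp only: image_insert image_empty)
  finally show ?thesis .
qed

theorem proposition4p4:
  fixes a :: "'n::finite \<Rightarrow> nat"
    and m :: "('n, 'k::field) mpoly"
    and I :: "('n, 'k) mpoly set"
  assumes m: "m = (\<Prod>i\<in>UNIV. Var i ^ a i)"
    and I: "I = PIdl\<^bsub>mpoly_ring\<^esub> m"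
  shows "(\<forall>J :: ('n, 'k) mpoly set. monomial_ideal J \<and> J \<subseteq> I \<longrightarrow>
            (demotion mpoly_ring J I \<longleftrightarrow>
              (\<exists>(t :: nat) (u :: nat \<Rightarrow> ('n, 'k) mpoly).
                 (\<forall>i\<in>{1..t}. u i \<in> monomials) \<and>
                 J = Idl\<^bsub>mpoly_ring\<^esub> {m * u i | i. i \<in> {1..t}} \<and>
                 min_monomial_gens J = {m * u i | i. i \<in> {1..t}} \<and>
                 (\<forall>i\<in>{1..t}. supp (u i) \<inter> supp m = {}))))
         \<and> (supp m \<subset> range Var \<longrightarrow>
              (\<exists>J :: ('n, 'k) mpoly set. proper_demotion mpoly_ring J I))"
proof -
  define \<alpha> where "\<alpha> = Abs_poly_mapping a"
  have m\<alpha>: "m = xpow \<alpha>" by (simp add: m \<alpha>_def prod_Var_power)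
  have I\<alpha>: "I = exponent_ideal {\<alpha>}" by (simp add: I m\<alpha> PIdl_xpow)
  have "demotion mpoly_ring J I \<longleftrightarrow>
      (\<exists>(t :: nat) (u :: nat \<Rightarrow> ('n, 'k) mpoly).
         (\<forall>i\<in>{1..t}. u i \<in> monomials) \<and>
         J = Idl\<^bsub>mpoly_ring\<^esub> {m * u i | i. i \<in> {1..t}} \<and>
         min_monomial_gens J = {m * u i | i. i \<in> {1..t}} \<and>
         (\<forall>i\<in>{1..t}. supp (u i) \<inter> supp m = {}))"
    (is "_ \<longleftrightarrow> ?gens")
    if J: "monomial_ideal J" "J \<subseteq> I" for J
  proof
    assume dem: "demotion mpoly_ring J I"
    obtain A where A: "J = exponent_ideal A"
      using J(1) unfolding monomial_ideal_def monomials_eq by (metis Idl_xpow subset_imageE)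
    obtain b where b: "bij_betw b {1..card (minimal_exps A)} (minimal_exps A)"
      using ex_bij_betw_nat_finite_1[OF finite_minimal_exps] by blast
    let ?t = "card (minimal_exps A)"
    define u :: "nat \<Rightarrow> ('n, 'k) mpoly" where "u = (\<lambda>i. xpow (b i - \<alpha>))"
    have agree: "lookup (b i) j = lookup \<alpha> j" if "i \<in> {1..?t}" "lookup \<alpha> j > 0" for i j
      using agree_on_support_if_demotion[OF dem[unfolded A I\<alpha>]] b that
      by (meson bij_betwE)
    \<comment> \<open>The agreement on the support of \<open>\<alpha>\<close> gives \<open>\<alpha> \<preceq> b i\<close>, so that the truncated difference is a
      genuine one.\<close>
    have sum: "\<alpha> + (b i - \<alpha>) = b i" if "i \<in> {1..?t}" for i
    proof (rule poly_mapping_eqI)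
      fix j show "lookup (\<alpha> + (b i - \<alpha>)) j = lookup (b i) j"
        using agree[OF that, of j] by (cases "lookup \<alpha> j") (auto simp: lookup_add lookup_minus)
    qed
    have "{m * u i | i. i \<in> {1..?t}} = (\<lambda>i. m * u i) ` {1..?t}" by blast
    also have "\<dots> = (\<lambda>i. xpow (b i)) ` {1..?t}"
      by (intro image_cong refl) (simp add: m\<alpha> u_def sum flip: xpow_add)
    also have "\<dots> = xpow ` b ` {1..?t}" by (simp only: image_image)
    also have "b ` {1..?t} = minimal_exps A" using b by (rule bij_betw_imp_surj_on)
    finally have gens: "{m * u i | i. i \<in> {1..?t}} = xpow ` minimal_exps A" .
    show ?gens
    proof (intro exI[of _ ?t] exI[of _ u] conjI ballI)
      show "u i \<in> monomials" for i by (simp add: u_def monomials_eq)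
      show "J = Idl\<^bsub>mpoly_ring\<^esub> {m * u i | i. i \<in> {1..?t}}"
        unfolding gens A by (rule Idl_minimal_exps[symmetric])
      show "min_monomial_gens J = {m * u i | i. i \<in> {1..?t}}"
        unfolding gens by (simp add: A min_monomial_gens_exponent_ideal)
      show "supp (u i) \<inter> supp m = {}" if "i \<in> {1..?t}" for i
        unfolding u_def m\<alpha> supp_disjoint_iff by (simp add: lookup_minus agree[OF that])
    qed
  next
    assume ?gens
    then obtain t :: nat and u :: "nat \<Rightarrow> ('n, 'k) mpoly" where
      u: "\<forall>i\<in>{1..t}. u i \<in> monomials" "J = Idl\<^bsub>mpoly_ring\<^esub> {m * u i | i. i \<in> {1..t}}"
        "\<forall>i\<in>{1..t}. supp (u i) \<inter> supp m = {}"
      by blast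
    from u(1) have "\<forall>i\<in>{1..t}. \<exists>c. u i = xpow c"
      by (auto simp: monomials_eq)
    then obtain c where c: "\<And>i. i \<in> {1..t} \<Longrightarrow> u i = xpow (c i)"
      by metis
    have "{m * u i | i. i \<in> {1..t}} = (\<lambda>i. m * u i) ` {1..t}" by blast
    also have "\<dots> = (\<lambda>i. xpow (\<alpha> + c i)) ` {1..t}"
      by (intro image_cong refl) (simp add: m\<alpha> c xpow_add)
    also have "\<dots> = xpow ` (\<lambda>i. \<alpha> + c i) ` {1..t}" by (simp add: image_image)
    finally have J: "J = exponent_ideal ((\<lambda>i. \<alpha> + c i) ` {1..t})"
      by (simp add: u(2) Idl_xpow)
    have "lookup (c i) j = 0" if "i \<in> {1..t}" "lookup \<alpha> j > 0" for i j
      using u(3) that by (simp add: c m\<alpha> supp_disjoint_iff)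
    then show "demotion mpoly_ring J I"
      unfolding J I\<alpha> by (intro demotion_if_agree_on_support) (auto simp: lookup_add)
  qed
  moreover have "\<exists>J :: ('n, 'k) mpoly set. proper_demotion mpoly_ring J I"
    if supp_m: "supp m \<subset> range Var"
  proof -
    obtain i where i: "Var i \<notin> supp m" using supp_m by blast
    then have i0: "lookup \<alpha> i = 0" by (auto simp: m\<alpha> supp_xpow)
    let ?b = "\<alpha> + Poly_Mapping.single i 1"
    have "demotion mpoly_ring (exponent_ideal {?b} :: ('n, 'k) mpoly set) I"
      unfolding I\<alpha> using i0
      by (intro demotion_if_agree_on_support) (auto simp: lookup_add lookup_single when_def)
    moreover have "\<not> ?b \<preceq> \<alpha>"
      by (auto simp: exp_le_def lookup_add intro!: exI[of _ i])
    then have "(exponent_ideal {?b} :: ('n, 'k) mpoly set) \<noteq> I"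
      unfolding I\<alpha> exponent_ideal_eq_iff by (auto simp: multiples_def)
    ultimately show ?thesis unfolding proper_demotion_def by blast
  qed
  ultimately show ?thesis by blast
qed

end
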